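(* The complete graph $K_4$ satisfies $\nu(K_4)=1$, $\tau(K_4)=2$ and $\Delta(K_4)=3$. The complete graph $K_5$ satisfies $\nu(K_5)=2$ and $\tau(K_5)=4$. For every integer $k\ge 1$ there are connected graphs $G_6$ and $G_7$ with $\Delta(G_6)\le 6$, $\Delta(G_7)=7$, $\nu(G_6)=\nu(G_7)=k$ and $\tau(G_6)=\tau(G_7)=2k$. Consequently, for no real $c<2$ does the inequality $\tau(G)\le c\,\nu(G)$ hold for all graphs $G$ with $\Delta(G)\le 7$, and the strict inequality $\tau(G)<2\nu(G)$ does not hold for all graphs $G$ with $\Delta(G)\le 7$.
   Context: All graphs are finite, simple and undirected. $\Delta(G)$ is the maximum degree of $G$. A triangle packing of $G$ is a set of pairwise edge-disjoint triangles of $G$ (they may share vertices); $\nu(G)$ is the largest size of a triangle packing. A triangle transversal of $G$ is a set $Y\subseteq E(G)$ such that $G-Y$ is triangle-free; $\tau(G)$ is the smallest size of a triangle transversal. *)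

theory Defs
  imports Complex_Main
begin

record 'a sgraph =
  verts :: "'a set"
  edges :: "'a set set"

definition simple_graph :: "'a sgraph \<Rightarrow> bool" where
  "simple_graph G \<longleftrightarrow>
     finite (verts G) \<and> edges G \<subseteq> {e. e \<subseteq> verts G \<and> card e = 2}"

definition vdegree :: "'a sgraph \<Rightarrow> 'a \<Rightarrow> nat" where
  "vdegree G v = card {e \<in> edges G. v \<in> e}"

(* The inserted 0 gives the graph without vertices maximum degree 0 and is
   harmless otherwise. *)
definition max_degree :: "'a sgraph \<Rightarrow> nat" where
  "max_degree G = Max (insert 0 (vdegree G ` verts G))"

definition connected_graph :: "'a sgraph \<Rightarrow> bool" where
  "connected_graph G \<longleftrightarrow> verts G \<noteq> {} \<and>
     (\<forall>u\<in>verts G. \<forall>v\<in>verts G. (u, v) \<in> {(x, y). {x, y} \<in> edges G}\<^sup>*)"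

(* A triangle is represented by its set of three edges, so that two triangles
   are edge-disjoint iff they are disjoint as sets. *)
definition triangles :: "'a sgraph \<Rightarrow> 'a set set set" where
  "triangles G = {{{x, y}, {y, z}, {x, z}} | x y z.
     x \<noteq> y \<and> y \<noteq> z \<and> x \<noteq> z \<and>
     {x, y} \<in> edges G \<and> {y, z} \<in> edges G \<and> {x, z} \<in> edges G}"

definition triangle_packing :: "'a sgraph \<Rightarrow> 'a set set set \<Rightarrow> bool" where
  "triangle_packing G P \<longleftrightarrow> P \<subseteq> triangles G \<and> pairwise disjnt P"

definition packing_number :: "'a sgraph \<Rightarrow> nat" where
  "packing_number G = Max {card P | P. triangle_packing G P}"

definition delete_edges :: "'a sgraph \<Rightarrow> 'a set set \<Rightarrow> 'a sgraph" where
  "delete_edges G Y = \<lparr>verts = verts G, edges = edges G - Y\<rparr>"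

definition triangle_transversal :: "'a sgraph \<Rightarrow> 'a set set \<Rightarrow> bool" where
  "triangle_transversal G Y \<longleftrightarrow> Y \<subseteq> edges G \<and> triangles (delete_edges G Y) = {}"

definition transversal_number :: "'a sgraph \<Rightarrow> nat" where
  "transversal_number G = Min {card Y | Y. triangle_transversal G Y}"

definition complete_graph :: "nat \<Rightarrow> nat sgraph" where
  "complete_graph n = \<lparr>verts = {..<n}, edges = {e. e \<subseteq> {..<n} \<and> card e = 2}\<rparr>"

end

theory Submission
  imports Defs "HOL-Library.Ramsey"
begin

text \<open>
  Both graphs are chains of \<open>k\<close> copies of $K_4$, consecutive copies sharing a single vertex,
  so that inner cut vertices have degree 6; four pendant edges at an end vertex of the chain
  raise the maximum degree to 7. Every triangle lies inside one copy of $K_4$. Two triangles in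
  the same copy share an edge, so a packing has at most one triangle per copy, while destroying
  the triangles of one copy takes two edges, for instance a perfect matching.

  In $K_5$, three triples of vertices that pairwise meet in at most one vertex would cover
  at least $9 - 3 = 6$ vertices; and there are 10 triangles, of which one edge meets only 3.
\<close>

section \<open>Triangles as the pairs of a three-element vertex set\<close>

lemma nsets_2_triple:
  assumes "x \<noteq> y" "y \<noteq> z" "x \<noteq> z"
  shows "nsets {x, y, z} 2 = {{x, y}, {y, z}, {x, z}}"
  using assms by (auto simp: nsets_2_eq insert_commute)

text \<open>A triangle is determined by its vertex set \<open>S\<close>, and
  \<open>nsets S 2\<close> is its edge set. In this form edge-disjointness and transversals become
  questions about intersections of vertex sets.\<close>

lemma triangles_eq:
  "triangles G = {nsets S 2 | S. card S = 3 \<and> nsets S 2 \<subseteq> edges G}"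
proof (intro equalityI subsetI)
  fix t assume "t \<in> triangles G"
  then obtain x y z where "x \<noteq> y" "y \<noteq> z" "x \<noteq> z"
    and t: "t = {{x, y}, {y, z}, {x, z}}"
    and e: "{x, y} \<in> edges G" "{y, z} \<in> edges G" "{x, z} \<in> edges G"
    unfolding triangles_def by blast
  then have "t = nsets {x, y, z} 2" "card {x, y, z} = 3"
    by (simp_all add: nsets_2_triple)
  moreover from this(1) have "nsets {x, y, z} 2 \<subseteq> edges G"
    unfolding t using e by (metis bot_least insert_subset)
  ultimately show "t \<in> {nsets S 2 | S. card S = 3 \<and> nsets S 2 \<subseteq> edges G}"
    by (intro CollectI exI[of _ "{x, y, z}"]) simp
next
  fix t assume "t \<in> {nsets S 2 | S. card S = 3 \<and> nsets S 2 \<subseteq> edges G}"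
  then obtain S where S: "card S = 3" "nsets S 2 \<subseteq> edges G" "t = nsets S 2" by blast
  obtain x y z where xyz: "S = {x, y, z}" "x \<noteq> y" "y \<noteq> z" "x \<noteq> z"
    using S(1) unfolding card_3_iff by auto
  show "t \<in> triangles G"
    unfolding triangles_def
    by (intro CollectI exI[of _ x] exI[of _ y] exI[of _ z])
      (use S(2,3) xyz in \<open>simp add: nsets_2_triple\<close>)
qed

lemma triangleI:
  assumes "card S = 3" "nsets S 2 \<subseteq> edges G"
  shows "nsets S 2 \<in> triangles G"
  using assms unfolding triangles_eq by blast

lemma triangleE:
  assumes "t \<in> triangles G"
  obtains S where "card S = 3" "t = nsets S 2" "nsets S 2 \<subseteq> edges G"
  using assms unfolding triangles_eq by auto

text \<open>A common edge is a pair inside \<open>A \<inter> B\<close>. Finiteness matters because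
  an infinite intersection would have \<open>card\<close> 0.\<close>

lemma disjnt_nsets_2_iff:
  assumes "finite A"
  shows "disjnt (nsets A 2) (nsets B 2) \<longleftrightarrow> card (A \<inter> B) \<le> 1"
proof -
  have "nsets A 2 \<inter> nsets B 2 = nsets (A \<inter> B) 2"
    by (auto simp: nsets_def)
  moreover have "nsets (A \<inter> B) 2 = {} \<longleftrightarrow> card (A \<inter> B) \<le> 1"
    using assms by (auto simp: nsets_eq_empty_iff)
  ultimately show ?thesis by (simp add: disjnt_def)
qed

lemma triangle_packing_common_edge:
  assumes "triangle_packing G P" "nsets A 2 \<in> P" "nsets B 2 \<in> P"
    and "finite A" "2 \<le> card (A \<inter> B)"
  shows "nsets A 2 = nsets B 2"
  using assms disjnt_nsets_2_iff[of A B]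
  by (auto simp: triangle_packing_def pairwise_def)

text \<open>Deleting \<open>Y\<close> destroys a triangle exactly when \<open>Y\<close> contains one
  of its edges. Both directions of the later bounds work with this hitting form.\<close>

lemma triangle_transversal_iff:
  "triangle_transversal G Y \<longleftrightarrow> Y \<subseteq> edges G \<and>
     (\<forall>S. card S = 3 \<longrightarrow> nsets S 2 \<subseteq> edges G \<longrightarrow> nsets S 2 \<inter> Y \<noteq> {})"
  unfolding triangle_transversal_def triangles_eq delete_edges_def
  by (simp add: subset_iff) blast

section \<open>Reduction of the graph parameters to bounds and neighbour counts\<close>

text \<open>The upper bound does double duty: it also makes the set of packing sizes finite, as
  \<open>Max\<close> requires.\<close>

lemma packing_number_eqI:
  assumes "triangle_packing G P" "card P = n"
    and "\<And>P. triangle_packing G P \<Longrightarrow> card P \<le> n"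
  shows "packing_number G = n"
  unfolding packing_number_def
proof (rule Max_eqI)
  show "finite {card P | P. triangle_packing G P}"
    by (rule finite_subset[of _ "{..n}"]) (use assms(3) in auto)
qed (use assms in auto)

text \<open>For the witness an upper bound on its size is enough, because \<open>le\<close> supplies
  the converse. The size of an explicit union then never has to be computed exactly.\<close>

lemma transversal_number_eqI:
  assumes fin: "finite (edges G)" and Y: "triangle_transversal G Y" "card Y \<le> n"
    and le: "\<And>Y. triangle_transversal G Y \<Longrightarrow> n \<le> card Y"
  shows "transversal_number G = n"
  unfolding transversal_number_def
proof (rule Min_eqI)
  show "finite {card Y | Y. triangle_transversal G Y}"
    by (rule finite_subset[of _ "{..card (edges G)}"])
      (use fin in \<open>auto simp: triangle_transversal_def intro: card_mono\<close>)
  show "n \<in> {card Y | Y. triangle_transversal G Y}"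
    using Y le[OF Y(1)] by (auto intro!: exI[of _ Y])
qed (use le in auto)

text \<open>An edge at \<open>v\<close> is determined by its other end, so sets of edges can be
  replaced by sets of vertices, here intervals of numbers.\<close>

lemma vdegree_eq_card_neighbours:
  assumes "simple_graph G"
  shows "vdegree G v = card {w. {v, w} \<in> edges G}"
proof -
  have "{e \<in> edges G. v \<in> e} = (\<lambda>w. {v, w}) ` {w. {v, w} \<in> edges G}"
  proof (intro equalityI subsetI)
    fix e assume e: "e \<in> {e \<in> edges G. v \<in> e}"
    then have "card e = 2" using assms by (auto simp: simple_graph_def)
    with e obtain w where "e = {v, w}" by (auto simp: card_2_iff)
    with e show "e \<in> (\<lambda>w. {v, w}) ` {w. {v, w} \<in> edges G}" by auto
  qed auto
  moreover have "inj_on (\<lambda>w. {v, w}) {w. {v, w} \<in> edges G}"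
    by (auto simp: inj_on_def doubleton_eq_iff)
  ultimately show ?thesis
    unfolding vdegree_def by (simp add: card_image)
qed

section \<open>Complete graphs, in particular $K_5$\<close>

lemma edges_complete_graph: "edges (complete_graph n) = nsets {..<n} 2"
  by (auto simp: complete_graph_def nsets_def dest: finite_subset)

lemma simple_complete_graph: "simple_graph (complete_graph n)"
  by (simp add: simple_graph_def complete_graph_def)

lemma max_degree_complete_graph:
  assumes "n > 0"
  shows "max_degree (complete_graph n) = n - 1"
proof -
  have deg: "vdegree (complete_graph n) v = n - 1" if "v < n" for v
  proof -
    have "{w. {v, w} \<in> edges (complete_graph n)} = {..<n} - {v}"
      using that by (auto simp: edges_complete_graph)
    then show ?thesis
      using that by (simp add: vdegree_eq_card_neighbours[OF simple_complete_graph])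
  qed
  have "verts (complete_graph n) = {..<n}" by (simp add: complete_graph_def)
  then have "vdegree (complete_graph n) ` verts (complete_graph n) = {n - 1}"
    using deg assms by (auto simp: image_iff)
  then show ?thesis by (simp add: max_degree_def)
qed

lemma packing_number_complete_graph_5: "packing_number (complete_graph 5) = 2"
proof (rule packing_number_eqI)
  \<comment> \<open>Two triangles that share only the vertex 0.\<close>
  let ?P = "{nsets {0, 1, 2::nat} 2, nsets {0, 3, 4} 2}"
  have dis: "disjnt (nsets {0, 1, 2::nat} 2) (nsets {0, 3, 4} 2)"
    by (simp add: disjnt_nsets_2_iff)
  moreover have "?P \<subseteq> triangles (complete_graph 5)"
  proof -
    have "nsets {0, 1, 2::nat} 2 \<in> triangles (complete_graph 5)"
      "nsets {0, 3, 4::nat} 2 \<in> triangles (complete_graph 5)"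
      by (rule triangleI; auto simp: edges_complete_graph nsets_2_triple)+
    then show ?thesis by simp
  qed
  ultimately show "triangle_packing (complete_graph 5) ?P"
    by (simp add: triangle_packing_def pairwise_insert disjnt_sym)
  have "{0, 1} \<in> nsets {0, 1, 2::nat} 2" by simp
  with dis have "nsets {0, 1, 2::nat} 2 \<noteq> nsets {0, 3, 4} 2"
    by (metis disjnt_iff)
  then show "card ?P = 2" by simp
next
  fix P assume P: "triangle_packing (complete_graph 5) P"
  show "card P \<le> 2"
  proof (rule ccontr)
    assume "\<not> card P \<le> 2"
    then obtain Q where "Q \<subseteq> P" "card Q = 3"
      by (metis not_less_eq_eq numeral_3_eq_3 numeral_2_eq_2 obtain_subset_with_card_n)
    then obtain a b c where abc: "{a, b, c} \<subseteq> P" "a \<noteq> b" "b \<noteq> c" "a \<noteq> c"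
      unfolding card_3_iff by auto
    have "\<exists>S\<subseteq>{..<5}. card S = 3 \<and> t = nsets S 2" if "t \<in> P" for t
    proof -
      have "t \<in> triangles (complete_graph 5)"
        using P that by (auto simp: triangle_packing_def)
      then obtain S where S: "card S = 3" "t = nsets S 2" "nsets S 2 \<subseteq> nsets {..<5} 2"
        unfolding edges_complete_graph[symmetric] by (rule triangleE)
      have "S \<subseteq> {..<5}"
        using S(1,3) by (auto simp: card_3_iff nsets_2_triple)
      with S show ?thesis by blast
    qed
    then obtain A B C where
      A: "A \<subseteq> {..<5}" "card A = 3" "a = nsets A 2" and
      B: "B \<subseteq> {..<5}" "card B = 3" "b = nsets B 2" and
      C: "C \<subseteq> {..<5}" "card C = 3" "c = nsets C 2"
      using abc(1) by (metis insert_subset)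
    have fin: "finite A" "finite B" "finite C"
      using A B C finite_subset by blast+
    have one: "card (X \<inter> Y) \<le> 1"
      if "nsets X 2 \<in> P" "nsets Y 2 \<in> P" "nsets X 2 \<noteq> nsets Y 2" "finite X" for X Y
      using triangle_packing_common_edge[OF P that(1,2,4)] that(3) by fastforce
    \<comment> \<open>Inclusion-exclusion: \<open>A \<union> B\<close> has at least 5 vertices and
      \<open>C\<close> meets it in at most 2, so the three triples cover at least 6 of only 5
      vertices.\<close>
    have "card (A \<inter> B) \<le> 1" "card (A \<inter> C) \<le> 1" "card (B \<inter> C) \<le> 1"
      by (rule one; use abc A(3) B(3) C(3) fin in simp)+
    moreover have "card (A \<union> B) + card (A \<inter> B) = 6"
      using card_Un_Int[OF fin(1,2)] A B by simp
    moreover have "card (A \<union> B \<union> C) + card ((A \<union> B) \<inter> C) = card (A \<union> B) + 3"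
      using card_Un_Int[of "A \<union> B" C] fin C by simp
    moreover have "card ((A \<union> B) \<inter> C) \<le> card (A \<inter> C) + card (B \<inter> C)"
      by (simp add: Int_Un_distrib2 card_Un_le)
    moreover have "card (A \<union> B \<union> C) \<le> card {..<5::nat}"
      using A B C by (intro card_mono) auto
    ultimately show False by simp
  qed
qed

lemma transversal_number_complete_graph_5: "transversal_number (complete_graph 5) = 4"
proof (rule transversal_number_eqI)
  show "finite (edges (complete_graph 5))"
    by (simp add: edges_complete_graph finite_imp_finite_nsets)
  \<comment> \<open>The edges of $K_5$ outside the complete bipartite graph between
    \<open>{0, 1}\<close> and \<open>{2, 3, 4}\<close>. Of any three vertices, two lie on the same
    side.\<close>
  let ?Y = "{{0, 1}, {2, 3}, {2, 4}, {3, 4::nat}}"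
  show "triangle_transversal (complete_graph 5) ?Y"
    unfolding triangle_transversal_iff edges_complete_graph
  proof (intro conjI allI impI)
    show "?Y \<subseteq> nsets {..<5} 2" by simp
    fix S :: "nat set" assume S: "card S = 3" "nsets S 2 \<subseteq> nsets {..<5} 2"
    have fin: "finite S" using S(1) by (simp add: card_ge_0_finite)
    have "S \<subseteq> {0, 1} \<union> {2, 3, 4}"
    proof -
      have "S \<subseteq> {..<5}" using S by (auto simp: card_3_iff nsets_2_triple)
      then show ?thesis by auto
    qed
    then have "card S \<le> card (S \<inter> {0, 1}) + card (S \<inter> {2, 3, 4})"
      by (metis Int_Un_distrib card_Un_le inf.absorb1)
    then have "2 \<le> card (S \<inter> {0, 1}) \<or> 2 \<le> card (S \<inter> {2, 3, 4})"
      using S(1) by linarith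
    then have "\<not> disjnt (nsets S 2) (nsets {0, 1} 2 \<union> nsets {2, 3, 4} 2)"
      using disjnt_nsets_2_iff[OF fin, of "{0, 1}"] disjnt_nsets_2_iff[OF fin, of "{2, 3, 4}"]
      by (auto simp: disjnt_Un2)
    moreover have "nsets {0, 1::nat} 2 \<union> nsets {2, 3, 4} 2 = ?Y"
      by (simp add: nsets_2_triple insert_commute)
    ultimately show "nsets S 2 \<inter> ?Y \<noteq> {}"
      by (metis disjnt_def)
  qed
  show "card ?Y \<le> 4" by (simp add: card_insert_if)
next
  fix Y assume Y: "triangle_transversal (complete_graph 5) Y"
  then have sub: "Y \<subseteq> nsets {..<5} 2"
    and hit: "\<And>S. card S = 3 \<Longrightarrow> nsets S 2 \<subseteq> nsets {..<5} 2 \<Longrightarrow> nsets S 2 \<inter> Y \<noteq> {}"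
    by (auto simp: triangle_transversal_iff edges_complete_graph)
  have fin: "finite Y"
    using sub by (rule finite_subset) (simp add: finite_imp_finite_nsets)
  \<comment> \<open>The triples of vertices that contain the edge \<open>e\<close>, one for each of
    the three remaining vertices.\<close>
  let ?T = "\<lambda>e. (\<lambda>z. insert z e) ` ({..<5} - e)"
  have "nsets {..<5} 3 \<subseteq> (\<Union>e\<in>Y. ?T e)"
  proof
    fix S :: "nat set" assume S: "S \<in> nsets {..<5} 3"
    then have S': "S \<subseteq> {..<5}" "card S = 3" "finite S" by (auto simp: nsets_def)
    then obtain e where e: "e \<in> nsets S 2" "e \<in> Y"
      using hit[of S] nsets_mono[of S "{..<5}"] by blast
    then have "card (S - e) = 1"
      using S' by (auto simp: nsets_def card_Diff_subset)
    then obtain z where "S - e = {z}" by (auto simp: card_1_singleton_iff)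
    then have "S = insert z e" "z \<in> {..<5} - e"
      using e S' by (auto simp: nsets_def)
    with e show "S \<in> (\<Union>e\<in>Y. ?T e)" by blast
  qed
  then have "card (nsets {..<5::nat} 3) \<le> card (\<Union>e\<in>Y. ?T e)"
    using fin by (intro card_mono) auto
  also have "\<dots> \<le> (\<Sum>e\<in>Y. card (?T e))"
    using fin by (rule card_UN_le)
  also have "\<dots> \<le> (\<Sum>e\<in>Y. 3)"
  proof (rule sum_mono)
    fix e assume "e \<in> Y"
    then have "e \<subseteq> {..<5}" "card e = 2" "finite e" using sub by (auto simp: nsets_def)
    then have "card ({..<5} - e) = 3" by (simp add: card_Diff_subset)
    then show "card (?T e) \<le> 3" by (metis card_image_le finite_Diff finite_lessThan)
  qed
  finally have "card (nsets {..<5::nat} 3) \<le> 3 * card Y" by simp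
  moreover have "card (nsets {..<5::nat} 3) = 5 choose 3"
    by (simp only: binomial_eq_nsets lessThan_atLeast0)
  moreover have "5 choose 3 = (10::nat)" by (simp add: numeral_eq_Suc)
  ultimately show "4 \<le> card Y" by simp
qed

section \<open>The chain of copies of $K_4$ and its degrees\<close>

abbreviation block :: "nat \<Rightarrow> nat set" where
  "block i \<equiv> {3 * i..3 * i + 3}"

text \<open>Block \<open>i\<close> ends at \<open>3 * i + 3\<close>, which is the first vertex of
  block \<open>i + 1\<close>. The \<open>p\<close> pendant vertices are numbered after all blocks
  and hang on the end vertex 0. The theorem uses \<open>p = 0\<close> and
  \<open>p = 4\<close>.\<close>

definition K4_chain :: "nat \<Rightarrow> nat \<Rightarrow> nat sgraph" where
  "K4_chain k p = \<lparr>verts = {..3 * k + p},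
     edges = (\<Union>i<k. nsets (block i) 2) \<union> {{0, j} | j. 3 * k < j \<and> j \<le> 3 * k + p}\<rparr>"

text \<open>Blocks are intervals, so for ordered ends it suffices to bound the smaller from below
  and the larger from above. A pendant edge has 0 as its smaller end.\<close>

lemma edge_K4_chain_iff:
  assumes "a < b"
  shows "{a, b} \<in> edges (K4_chain k p) \<longleftrightarrow>
    (\<exists>i<k. 3 * i \<le> a \<and> b \<le> 3 * i + 3) \<or> a = 0 \<and> 3 * k < b \<and> b \<le> 3 * k + p"
  using assms by (auto simp: K4_chain_def doubleton_eq_iff)

lemma simple_K4_chain: "simple_graph (K4_chain k p)"
  by (auto simp: simple_graph_def K4_chain_def nsets_def subset_iff)

lemma finite_edges_K4_chain: "finite (edges (K4_chain k p))"
  using simple_K4_chain[of k p] unfolding simple_graph_def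
  by (metis (no_types, lifting) finite_Collect_subsets finite_subset mem_Collect_eq subsetI subset_iff)

text \<open>One block without pendant edges: the packing and transversal numbers of $K_4$ are
  instances of those of the chain.\<close>

lemma complete_graph_4_eq: "complete_graph 4 = K4_chain 1 0"
proof -
  have "{..<4::nat} = {0..3}" by auto
  then show ?thesis
    using edges_complete_graph[of 4] by (auto simp: complete_graph_def K4_chain_def)
qed

lemma connected_K4_chain: "connected_graph (K4_chain k p)"
proof -
  let ?R = "{(x, y). {x, y} \<in> edges (K4_chain k p)}"
  have sym: "sym (?R\<^sup>*)"
    by (rule sym_rtrancl) (auto simp: sym_def insert_commute)
  have root: "(0, v) \<in> ?R\<^sup>*" if "v \<le> 3 * k + p" for v
    using that
  proof (induction v rule: less_induct)
    case (less v)
    consider "v = 0" | "3 * k < v" | "0 < v" "v \<le> 3 * k" by linarith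
    then show ?case
    proof cases
      case 1
      then show ?thesis by simp
    next
      case 2
      then have "{0, v} \<in> edges (K4_chain k p)"
        using less.prems by (subst edge_K4_chain_iff) auto
      then show ?thesis by auto
    next
      case 3
      \<comment> \<open>Subtracting 1 assigns a shared vertex to the earlier of its two blocks, so
        that \<open>3 * i\<close> is strictly below \<open>v\<close> and the induction hypothesis
        applies.\<close>
      define i where "i = (v - 1) div 3"
      have i: "i < k" "3 * i < v" "v \<le> 3 * i + 3" using 3 unfolding i_def by auto
      then have "{3 * i, v} \<in> edges (K4_chain k p)"
        by (subst edge_K4_chain_iff) auto
      moreover have "(0, 3 * i) \<in> ?R\<^sup>*"
        using less i by auto
      ultimately show ?thesis
        by (auto intro: rtrancl_into_rtrancl)
    qed
  qed
  have "(u, v) \<in> ?R\<^sup>*" if "u \<le> 3 * k + p" "v \<le> 3 * k + p" for u v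
    using symD[OF sym root[OF that(1)]] root[OF that(2)] by (rule rtrancl_trans)
  then show ?thesis by (auto simp: connected_graph_def K4_chain_def)
qed

text \<open>The vertex 0 lies in the first block only, which gives 3 neighbours; the other
  \<open>p\<close> are the pendant vertices.\<close>

lemma vdegree_K4_chain_0:
  assumes "k \<ge> 1"
  shows "vdegree (K4_chain k p) 0 = p + 3"
proof -
  have "{w. {0, w} \<in> edges (K4_chain k p)} = {1..3} \<union> {3 * k<..3 * k + p}" (is "?N = _")
  proof (intro set_eqI)
    fix w
    show "w \<in> ?N \<longleftrightarrow> w \<in> {1..3} \<union> {3 * k<..3 * k + p}"
    proof (cases "w = 0")
      case True
      have "{0, 0} \<notin> edges (K4_chain k p)"
        using simple_K4_chain[of k p] by (auto simp: simple_graph_def)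
      with True show ?thesis by auto
    next
      case False
      then show ?thesis using assms by (auto simp: edge_K4_chain_iff)
    qed
  qed
  moreover have "{1..3} \<inter> {3 * k<..3 * k + p} = {}" using assms by auto
  ultimately show ?thesis
    by (simp add: vdegree_eq_card_neighbours[OF simple_K4_chain] card_Un_disjoint)
qed

text \<open>Neighbours within a block differ by at most 3 in number, which leaves at most three on
  each side of \<open>v\<close>. A pendant vertex is adjacent to 0 alone.\<close>

lemma vdegree_K4_chain_le:
  assumes "v \<noteq> 0"
  shows "vdegree (K4_chain k p) v \<le> 6"
proof -
  let ?N = "{w. {v, w} \<in> edges (K4_chain k p)}"
  have *: "if v \<le> 3 * k then w \<noteq> v \<and> v \<le> w + 3 \<and> w \<le> v + 3 else w = 0" if "w \<in> ?N" for w
  proof -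
    have "v \<noteq> w"
      using that simple_K4_chain[of k p] by (auto simp: simple_graph_def)
    then consider "v < w" | "w < v" by linarith
    then show ?thesis
    proof cases
      case 1
      then show ?thesis using that assms by (auto simp: edge_K4_chain_iff)
    next
      case 2
      then show ?thesis
        using that by (auto simp: edge_K4_chain_iff insert_commute[of v w])
    qed
  qed
  have "card ?N \<le> 6"
  proof (cases "v \<le> 3 * k")
    case True
    \<comment> \<open>For \<open>v < 3\<close> the truncated \<open>v - 3\<close> is 0, which only
      shortens the interval.\<close>
    then have "?N \<subseteq> {v - 3..v + 3} - {v}" using * by fastforce
    then have "card ?N \<le> card ({v - 3..v + 3} - {v})" by (intro card_mono) auto
    also have "\<dots> \<le> 6" by simp
    finally show ?thesis .
  next
    case False
    then have "?N \<subseteq> {0}" using * by auto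
    then have "card ?N \<le> card {0::nat}" by (intro card_mono) auto
    then show ?thesis by simp
  qed
  then show ?thesis by (simp add: vdegree_eq_card_neighbours[OF simple_K4_chain])
qed

text \<open>In general only a bound: a single block without pendant edges has maximum degree
  3.\<close>

lemma max_degree_K4_chain_le:
  assumes "k \<ge> 1"
  shows "max_degree (K4_chain k p) \<le> max 6 (p + 3)"
proof -
  have "vdegree (K4_chain k p) v \<le> max 6 (p + 3)" for v
    using vdegree_K4_chain_0[OF assms, of p] vdegree_K4_chain_le[of v k p]
    by (cases "v = 0") auto
  then show ?thesis
    by (auto simp: max_degree_def K4_chain_def)
qed

lemma max_degree_K4_chain_ge:
  assumes "k \<ge> 1"
  shows "p + 3 \<le> max_degree (K4_chain k p)"
proof -
  have "vdegree (K4_chain k p) 0 \<in> insert 0 (vdegree (K4_chain k p) ` verts (K4_chain k p))"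
    by (auto simp: K4_chain_def)
  moreover have "finite (insert 0 (vdegree (K4_chain k p) ` verts (K4_chain k p)))"
    by (simp add: K4_chain_def)
  ultimately have "vdegree (K4_chain k p) 0 \<le> max_degree (K4_chain k p)"
    unfolding max_degree_def by (rule Max_ge[rotated])
  then show ?thesis by (simp add: vdegree_K4_chain_0[OF assms])
qed

section \<open>Packings and transversals of the chain\<close>

text \<open>For vertices \<open>x < y < z\<close> the edge \<open>{y, z}\<close> has a nonzero
  smaller end, so it is not pendant and \<open>z\<close> is at most \<open>3 * k\<close>. Hence
  \<open>{x, z}\<close> is not pendant either, and the block containing it, being an interval,
  contains \<open>y\<close>.\<close>

lemma triangle_K4_chain_in_block:
  assumes "card S = 3" "nsets S 2 \<subseteq> edges (K4_chain k p)"
  shows "\<exists>i<k. S \<subseteq> block i"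
proof -
  have "\<exists>x y z. S = {x, y, z} \<and> x < y \<and> y < z"
  proof -
    obtain a b c where "S = {a, b, c}" "a \<noteq> b" "b \<noteq> c" "a \<noteq> c"
      using assms(1) unfolding card_3_iff by auto
    then show ?thesis
      by (metis insert_commute linorder_neqE_nat)
  qed
  then obtain x y z where S: "S = {x, y, z}" "x < y" "y < z" by blast
  then have "{x, z} \<in> edges (K4_chain k p)" "{y, z} \<in> edges (K4_chain k p)"
    using assms(2) by (auto simp: nsets_2_triple)
  then have "\<exists>i<k. 3 * i \<le> x \<and> z \<le> 3 * i + 3"
    using S by (auto simp: edge_K4_chain_iff)
  then show ?thesis using S by fastforce
qed

lemma packing_number_K4_chain: "packing_number (K4_chain k p) = k"
proof (rule packing_number_eqI)
  \<comment> \<open>Leaving out the last vertex of each block makes the chosen triples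
    vertex-disjoint.\<close>
  let ?S = "\<lambda>i. {3 * i..3 * i + 2::nat}"
  let ?P = "(\<lambda>i. nsets (?S i) 2) ` {..<k}"
  have dis: "disjnt (nsets (?S i) 2) (nsets (?S j) 2)" if "i \<noteq> j" for i j
  proof -
    have "?S i \<inter> ?S j = {}" using that by auto
    then show ?thesis by (simp add: disjnt_nsets_2_iff)
  qed
  \<comment> \<open>Nonemptiness turns disjointness of the triangles into distinctness, which the
    injectivity below needs.\<close>
  have ne: "{3 * i, 3 * i + 1} \<in> nsets (?S i) 2" for i by simp
  have "nsets (?S i) 2 \<in> triangles (K4_chain k p)" if "i < k" for i
  proof -
    have "nsets (?S i) 2 \<subseteq> nsets (block i) 2" by (rule nsets_mono) auto
    also have "\<dots> \<subseteq> edges (K4_chain k p)" using that by (auto simp: K4_chain_def)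
    finally show ?thesis by (auto simp: triangles_eq)
  qed
  moreover have "pairwise disjnt ?P"
    unfolding pairwise_image by (rule pairwiseI) (use dis in blast)
  ultimately show "triangle_packing (K4_chain k p) ?P"
    by (auto simp: triangle_packing_def)
  have "inj_on (\<lambda>i. nsets (?S i) 2) {..<k}"
    using dis ne by (metis (no_types, lifting) disjnt_iff inj_onI)
  then show "card ?P = k" by (simp add: card_image)
next
  fix P assume P: "triangle_packing (K4_chain k p) P"
  have "\<exists>i<k. \<exists>S\<subseteq>block i. card S = 3 \<and> t = nsets S 2" if "t \<in> P" for t
  proof -
    have "t \<in> triangles (K4_chain k p)"
      using P that by (auto simp: triangle_packing_def)
    then obtain S where "card S = 3" "t = nsets S 2" "nsets S 2 \<subseteq> edges (K4_chain k p)"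
      by (rule triangleE)
    with triangle_K4_chain_in_block[of S k p] show ?thesis by blast
  qed
  then obtain f where f: "\<And>t. t \<in> P \<Longrightarrow> f t < k"
    "\<And>t. t \<in> P \<Longrightarrow> \<exists>S\<subseteq>block (f t). card S = 3 \<and> t = nsets S 2"
    by metis
  have "inj_on f P"
  proof (rule inj_onI)
    fix s t assume st: "s \<in> P" "t \<in> P" "f s = f t"
    obtain A where A: "A \<subseteq> block (f s)" "card A = 3" "s = nsets A 2" using f(2) st by blast
    obtain B where B: "B \<subseteq> block (f s)" "card B = 3" "t = nsets B 2" using f(2) st by metis
    have fin: "finite A" "finite B" using A B finite_subset by blast+
    have "card (A \<union> B) \<le> card (block (f s))"
      using A B by (intro card_mono) auto
    \<comment> \<open>Two triples inside a block of 4 vertices meet in at least 3 + 3 - 4 = 2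
      vertices.\<close>
    then have "2 \<le> card (A \<inter> B)"
      using card_Un_Int[OF fin] A B by simp
    then show "s = t"
      using triangle_packing_common_edge[OF P] st fin A B by blast
  qed
  moreover have "f ` P \<subseteq> {..<k}" using f(1) by auto
  ultimately have "card P \<le> card {..<k}" by (rule card_inj_on_le) simp
  then show "card P \<le> k" by simp
qed

lemma transversal_number_K4_chain: "transversal_number (K4_chain k p) = 2 * k"
proof (rule transversal_number_eqI)
  show "finite (edges (K4_chain k p))" by (rule finite_edges_K4_chain)
  \<comment> \<open>A perfect matching of block \<open>i\<close>: any three of the four vertices
    include both ends of one of its edges.\<close>
  let ?M = "\<lambda>i. {{3 * i, 3 * i + 1}, {3 * i + 2, 3 * i + 3::nat}}"
  define X where "X = (\<Union>i<k. ?M i)"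
  show "triangle_transversal (K4_chain k p) X"
    unfolding triangle_transversal_iff
  proof (intro conjI allI impI)
    have "X \<subseteq> (\<Union>i<k. nsets (block i) 2)" unfolding X_def by (rule UN_mono) auto
    also have "\<dots> \<subseteq> edges (K4_chain k p)" by (simp add: K4_chain_def)
    finally show "X \<subseteq> edges (K4_chain k p)" .
    fix S assume S: "card S = 3" "nsets S 2 \<subseteq> edges (K4_chain k p)"
    then obtain i where i: "i < k" "S \<subseteq> block i"
      using triangle_K4_chain_in_block by blast
    have fin: "finite S" using S(1) by (simp add: card_ge_0_finite)
    have "block i = {3 * i, 3 * i + 1} \<union> {3 * i + 2, 3 * i + 3}" by auto
    then have "card S \<le> card (S \<inter> {3 * i, 3 * i + 1}) + card (S \<inter> {3 * i + 2, 3 * i + 3})"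
      using i by (metis Int_Un_distrib card_Un_le inf.absorb1)
    then have "2 \<le> card (S \<inter> {3 * i, 3 * i + 1}) \<or> 2 \<le> card (S \<inter> {3 * i + 2, 3 * i + 3})"
      using S(1) by linarith
    then have "\<not> disjnt (nsets S 2) (nsets {3 * i, 3 * i + 1} 2 \<union> nsets {3 * i + 2, 3 * i + 3} 2)"
      using disjnt_nsets_2_iff[OF fin, of "{3 * i, 3 * i + 1}"]
        disjnt_nsets_2_iff[OF fin, of "{3 * i + 2, 3 * i + 3}"]
      by (auto simp: disjnt_Un2)
    moreover have "nsets {3 * i, 3 * i + 1} 2 \<union> nsets {3 * i + 2, 3 * i + 3} 2 = ?M i"
      by (simp add: insert_commute)
    ultimately have "nsets S 2 \<inter> ?M i \<noteq> {}" by (metis disjnt_def)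
    then obtain e where e: "e \<in> nsets S 2" "e \<in> ?M i" by (meson disjoint_iff)
    then have "e \<in> X" using i(1) unfolding X_def by (intro UN_I[of i]) simp_all
    with e(1) show "nsets S 2 \<inter> X \<noteq> {}" by (metis IntI empty_iff)
  qed
  have "card X \<le> (\<Sum>i<k. card (?M i))" unfolding X_def by (rule card_UN_le) simp
  also have "\<dots> \<le> (\<Sum>i<k. 2)" by (intro sum_mono) (simp add: card_insert_if)
  finally show "card X \<le> 2 * k" by simp
next
  fix Y assume Y: "triangle_transversal (K4_chain k p) Y"
  then have hit: "\<And>S. card S = 3 \<Longrightarrow> nsets S 2 \<subseteq> edges (K4_chain k p) \<Longrightarrow> nsets S 2 \<inter> Y \<noteq> {}"
    by (auto simp: triangle_transversal_iff)
  have finY: "finite Y"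
    using Y finite_edges_K4_chain finite_subset unfolding triangle_transversal_def by blast
  let ?Z = "\<lambda>i. Y \<inter> nsets (block i) 2"
  \<comment> \<open>A single edge \<open>e\<close> cannot do: omitting an end of \<open>e\<close>
    from the block leaves a triangle that avoids \<open>e\<close>.\<close>
  have two: "2 \<le> card (?Z i)" if "i < k" for i
  proof (rule ccontr)
    assume "\<not> 2 \<le> card (?Z i)"
    then have "card (?Z i) \<le> 1" by simp
    moreover have hit_block: "nsets (block i - {a}) 2 \<inter> ?Z i \<noteq> {}" if "a \<in> block i" for a
    proof -
      have "nsets (block i - {a}) 2 \<subseteq> nsets (block i) 2" by (rule nsets_mono) auto
      moreover have "nsets (block i) 2 \<subseteq> edges (K4_chain k p)"
        using \<open>i < k\<close> by (auto simp: K4_chain_def)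
      moreover have "card (block i - {a}) = 3" using that by simp
      ultimately show ?thesis using hit[of "block i - {a}"] by blast
    qed
    ultimately obtain e where e: "?Z i = {e}"
      using hit_block[of "3 * i"] finY
      by (metis (no_types, lifting) One_nat_def atLeastAtMost_iff card_0_eq card_1_singletonE
          finite_Int inf_bot_right le_SucE le_add1 le_refl le_zero_eq)
    then have "e \<in> nsets (block i) 2" by blast
    then have "e \<subseteq> block i" "e \<noteq> {}" by (auto simp: nsets_def)
    then obtain a where a: "a \<in> e" "a \<in> block i" by blast
    then have "nsets (block i - {a}) 2 \<inter> ?Z i = {}"
      unfolding e by (auto simp: nsets_def)
    with hit_block[OF a(2)] show False by blast
  qed
  \<comment> \<open>Different blocks share at most one vertex, hence no edge, so the counts per
    block add up.\<close>
  have dis: "?Z i \<inter> ?Z j = {}" if "i \<noteq> j" for i j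
  proof -
    have "card (block i \<inter> block j) \<le> 1"
    proof -
      \<comment> \<open>A shared vertex can only be the first vertex of the later block.\<close>
      have "block i \<inter> block j \<subseteq> {3 * max i j}" using that by auto
      from card_mono[OF _ this] show ?thesis by (simp del: Int_atLeastAtMost)
    qed
    then show ?thesis
      using disjnt_nsets_2_iff[of "block i" "block j"] by (auto simp: disjnt_def)
  qed
  have "2 * k = (\<Sum>i<k. 2)" by simp
  also have "\<dots> \<le> (\<Sum>i<k. card (?Z i))" using two by (intro sum_mono) simp
  also have "\<dots> = card (\<Union>i<k. ?Z i)"
    using finY dis by (subst card_UN_disjoint) auto
  also have "\<dots> \<le> card Y" using finY by (intro card_mono) auto
  finally show "2 * k \<le> card Y" .
qed

theorem proposition1p5:
  shows "(packing_number (complete_graph 4) = 1 \<and>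
          transversal_number (complete_graph 4) = 2 \<and>
          max_degree (complete_graph 4) = 3) \<and>
         (packing_number (complete_graph 5) = 2 \<and>
          transversal_number (complete_graph 5) = 4) \<and>
         (\<forall>k::nat. k \<ge> 1 \<longrightarrow>
            (\<exists>(G6 :: nat sgraph) (G7 :: nat sgraph).
               simple_graph G6 \<and> connected_graph G6 \<and> max_degree G6 \<le> 6 \<and>
               simple_graph G7 \<and> connected_graph G7 \<and> max_degree G7 = 7 \<and>
               packing_number G6 = k \<and> packing_number G7 = k \<and>
               transversal_number G6 = 2 * k \<and> transversal_number G7 = 2 * k)) \<and>
         (\<forall>c::real. c < 2 \<longrightarrow>
            \<not> (\<forall>G :: nat sgraph. simple_graph G \<and> max_degree G \<le> 7 \<longrightarrow>
                  real (transversal_number G) \<le> c * real (packing_number G))) \<and>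
         \<not> (\<forall>G :: nat sgraph. simple_graph G \<and> max_degree G \<le> 7 \<longrightarrow>
                transversal_number G < 2 * packing_number G)"
proof -
  have deg7: "max_degree (K4_chain k 4) = 7" if "k \<ge> 1" for k
    using max_degree_K4_chain_le[OF that, of 4] max_degree_K4_chain_ge[OF that, of 4] by simp
  have chains: "\<exists>(G6 :: nat sgraph) (G7 :: nat sgraph).
               simple_graph G6 \<and> connected_graph G6 \<and> max_degree G6 \<le> 6 \<and>
               simple_graph G7 \<and> connected_graph G7 \<and> max_degree G7 = 7 \<and>
               packing_number G6 = k \<and> packing_number G7 = k \<and>
               transversal_number G6 = 2 * k \<and> transversal_number G7 = 2 * k"
    if "k \<ge> 1" for k
    using max_degree_K4_chain_le[OF that, of 0] deg7[OF that]
    by (intro exI[of _ "K4_chain k 0"] exI[of _ "K4_chain k 4"])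
      (simp add: simple_K4_chain connected_K4_chain packing_number_K4_chain
        transversal_number_K4_chain)
  have K4: "packing_number (complete_graph 4) = 1" "transversal_number (complete_graph 4) = 2"
    by (simp_all add: complete_graph_4_eq packing_number_K4_chain transversal_number_K4_chain)
  have K4_deg: "max_degree (complete_graph 4) = 3"
    by (simp add: max_degree_complete_graph)
  show ?thesis
  proof (intro conjI allI impI notI)
    fix c :: real
    assume "c < 2" and "\<forall>G :: nat sgraph. simple_graph G \<and> max_degree G \<le> 7 \<longrightarrow>
                  real (transversal_number G) \<le> c * real (packing_number G)"
    \<comment> \<open>$K_4$ already refutes both inequalities: here it would give
      \<open>2 \<le> c\<close>.\<close>
    then have "real (transversal_number (complete_graph 4))
        \<le> c * real (packing_number (complete_graph 4))"
      by (simp add: simple_complete_graph K4_deg)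
    with \<open>c < 2\<close> show False by (simp add: K4)
  next
    assume "\<forall>G :: nat sgraph. simple_graph G \<and> max_degree G \<le> 7 \<longrightarrow>
                transversal_number G < 2 * packing_number G"
    then have "transversal_number (complete_graph 4) < 2 * packing_number (complete_graph 4)"
      by (simp add: simple_complete_graph K4_deg)
    then show False by (simp add: K4)
  qed (use chains K4 K4_deg packing_number_complete_graph_5
      transversal_number_complete_graph_5 in simp_all)
qed

end
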